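(* Let $Y:\mathbb{R}\to(0,\infty)$ be the Hastings-McLeod solution of $Y''-xY-2Y^3=0$ on $\mathbb{R}$. Let $y:\mathbb{R}^2\to\mathbb{R}$ be a (classical) solution of $$\Delta y-x_1y-2y^3=0,\qquad (x_1,x_2)\in\mathbb{R}^2,$$ such that $$y_{x_2}>0 \quad\text{in } \mathbb{R}^2,$$ and $$y(x_1,x_2+l)\to Y(x_1)\ \text{ as } l\to+\infty,\qquad y(x_1,x_2+l)\to -Y(x_1)\ \text{ as } l\to-\infty,$$ both convergences being in $C^2_{loc}(\mathbb{R}^2)$ (as functions of $(x_1,x_2)$). Then $y$ is an energy minimizer in the sense of Morse, that is, $$E(y,\mathrm{supp}\,\phi)\leq E(y+\phi,\mathrm{supp}\,\phi)\qquad \text{for all } \phi\in C_0^\infty(\mathbb{R}^2),$$ where, for any bounded subset $\Omega$ of $\mathbb{R}^2$, $$E(u,\Omega)=\int_{\Omega}\left[\frac12|\nabla u|^2+\frac12 x_1u^2+\frac12u^4\right]dx_1\,dx_2 .$$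
   Context: The Hastings-McLeod solution $Y$ is the unique positive solution, defined on all of $\mathbb{R}$, of the Painlev\'e-II equation $Y''-xY-2Y^3=0$. It satisfies $Y'<0$ on $\mathbb{R}$, $Y(x)-\sqrt{-x/2}\to 0$ as $x\to-\infty$, and $Y(x)\to 0$ as $x\to+\infty$. $C_0^\infty(\mathbb{R}^2)$ denotes the real-valued smooth functions with compact support in $\mathbb{R}^2$, and $\mathrm{supp}\,\phi$ is the support of $\phi$. Convergence in $C^2_{loc}(\mathbb{R}^2)$ means uniform convergence on compact subsets of $\mathbb{R}^2$ of the functions together with their partial derivatives up to order two. Subscripts such as $y_{x_2}$ denote partial derivatives. *)

theory Defs
  imports "HOL-Analysis.Analysis"
begin

definition D1 :: "(real \<times> real \<Rightarrow> real) \<Rightarrow> real \<times> real \<Rightarrow> real" where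
  "D1 u = (\<lambda>(x1, x2). deriv (\<lambda>s. u (s, x2)) x1)"

definition D2 :: "(real \<times> real \<Rightarrow> real) \<Rightarrow> real \<times> real \<Rightarrow> real" where
  "D2 u = (\<lambda>(x1, x2). deriv (\<lambda>s. u (x1, s)) x2)"

text \<open>
  Since \<^const>\<open>deriv\<close> is unspecified at points of non-differentiability, existence of the
  partial derivatives is demanded separately.
\<close>

primrec Ck :: "nat \<Rightarrow> (real \<times> real \<Rightarrow> real) \<Rightarrow> bool" where
  "Ck 0 u \<longleftrightarrow> continuous_on UNIV u"
| "Ck (Suc k) u \<longleftrightarrow>
     continuous_on UNIV u \<and>
     (\<forall>x1 x2. (\<lambda>s. u (s, x2)) differentiable (at x1) \<and>
              (\<lambda>s. u (x1, s)) differentiable (at x2)) \<and>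
     Ck k (D1 u) \<and> Ck k (D2 u)"

definition laplacian :: "(real \<times> real \<Rightarrow> real) \<Rightarrow> real \<times> real \<Rightarrow> real" where
  "laplacian u p = D1 (D1 u) p + D2 (D2 u) p"

definition supp :: "(real \<times> real \<Rightarrow> real) \<Rightarrow> (real \<times> real) set" where
  "supp u = closure {p. u p \<noteq> 0}"

definition test_function :: "(real \<times> real \<Rightarrow> real) \<Rightarrow> bool" where
  "test_function u \<longleftrightarrow> (\<forall>k. Ck k u) \<and> compact (supp u)"

definition tendsto_C2_loc ::
    "('i \<Rightarrow> real \<times> real \<Rightarrow> real) \<Rightarrow> (real \<times> real \<Rightarrow> real) \<Rightarrow> 'i filter \<Rightarrow> bool" where
  "tendsto_C2_loc u v F \<longleftrightarrow>
     (\<forall>K. compact K \<longrightarrow>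
       uniform_limit K u v F \<and>
       uniform_limit K (\<lambda>i. D1 (u i)) (D1 v) F \<and>
       uniform_limit K (\<lambda>i. D2 (u i)) (D2 v) F \<and>
       uniform_limit K (\<lambda>i. D1 (D1 (u i))) (D1 (D1 v)) F \<and>
       uniform_limit K (\<lambda>i. D1 (D2 (u i))) (D1 (D2 v)) F \<and>
       uniform_limit K (\<lambda>i. D2 (D1 (u i))) (D2 (D1 v)) F \<and>
       uniform_limit K (\<lambda>i. D2 (D2 (u i))) (D2 (D2 v)) F)"

text \<open>
  There is exactly one positive solution of this Painleve-II equation on the whole line, so the
  predicate singles out one function. Its monotonicity and its asymptotics at plus and minus
  infinity are consequences and are not part of the definition.
\<close>

definition hastings_mcleod :: "(real \<Rightarrow> real) \<Rightarrow> bool" where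
  "hastings_mcleod Y \<longleftrightarrow>
     (\<forall>x. Y x > 0) \<and>
     (\<forall>x. Y differentiable (at x)) \<and>
     (\<forall>x. deriv Y differentiable (at x)) \<and>
     (\<forall>x. deriv (deriv Y) x - x * Y x - 2 * Y x ^ 3 = 0)"

definition energy :: "(real \<times> real \<Rightarrow> real) \<Rightarrow> (real \<times> real) set \<Rightarrow> real" where
  "energy u \<Omega> =
     (LINT p:\<Omega>|lebesgue.
        1/2 * ((D1 u p)\<^sup>2 + (D2 u p)\<^sup>2) + 1/2 * fst p * (u p)\<^sup>2 + 1/2 * (u p) ^ 4)"

end

theory Submission
  imports Defs
begin

text \<open>
  The translates of \<open>y\<close> in the second variable are solutions as well, and since \<open>y\<close> is increasing
  in that variable and tends to \<open>\<plusminus>Y\<close>, their graphs foliate the region between the graphs of \<open>-Y\<close>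
  and \<open>Y\<close>. By the field theory of Weierstrass, a leaf of a foliation by extremals minimizes the energy
  among all competitors whose graphs remain in the foliated region: the slope field \<open>P\<close> of the leaves
  yields a null Lagrangian that bounds the energy density from below, with equality on the leaves.
  Since the equation does not involve the second variable, this null Lagrangian can be written as an
  explicit divergence, using the stream function of the conserved Noether current
  (\<open>noether_stream_function\<close>, \<open>calibration_divergence\<close>, \<open>foliation_minimizes\<close>).

  A general competitor \<open>v = y + \<phi>\<close> may leave the region \<open>|v| < Y\<close>. Because \<open>Y\<close> is itself a positive
  solution, the substitution \<open>v = Y w\<close> turns the energy, up to boundary terms and a constant, into
  \<open>\<integral> Y\<^sup>2 |\<nabla>w|\<^sup>2 / 2 + Y\<^sup>4 (w\<^sup>2 - 1)\<^sup>2 / 2\<close> (\<open>picone_identity\<close>). Truncating \<open>w\<close> at \<open>\<plusminus>1\<close> lowers this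
  integral. A \<open>C\<^sup>1\<close> truncation with values strictly between \<open>-1\<close> and \<open>1\<close>, as the foliation
  requires, raises it by at most an arbitrarily small amount (\<open>truncation_energy\<close>). Minimality against
  all competitors follows in the limit.

  The limits enter through the fact that \<open>t \<mapsto> y(x1, t)\<close> maps the line onto the interval from
  \<open>-Y(x1)\<close> to \<open>Y(x1)\<close>, so that the leaves reach every point of the foliated region
  (\<open>range_of_increasing\<close>).
\<close>

section \<open>Plane functions with continuous partial derivatives\<close>

text \<open>
  The partial derivatives are carried along as arguments, because the competitors built below come
  with formulas for their partial derivatives rather than as \<^const>\<open>deriv\<close> terms.
\<close>

definition C1_gradient ::
    "(real \<times> real \<Rightarrow> real) \<Rightarrow> (real \<times> real \<Rightarrow> real) \<Rightarrow> (real \<times> real \<Rightarrow> real) \<Rightarrow> bool" where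
  "C1_gradient f a b \<longleftrightarrow>
     (\<forall>x t. ((\<lambda>s. f (s, t)) has_real_derivative a (x, t)) (at x)) \<and>
     (\<forall>x t. ((\<lambda>s. f (x, s)) has_real_derivative b (x, t)) (at t)) \<and>
     continuous_on UNIV a \<and> continuous_on UNIV b"

lemma C1_gradientD:
  assumes "C1_gradient f a b"
  shows "((\<lambda>s. f (s, t)) has_real_derivative a (x, t)) (at x)"
    and "((\<lambda>s. f (x, s)) has_real_derivative b (x, t)) (at t)"
    and "continuous_on UNIV a" and "continuous_on UNIV b"
  using assms by (auto simp: C1_gradient_def)

lemma C1_gradient_has_derivative:
  assumes "C1_gradient f a b"
  shows "(f has_derivative (\<lambda>h. a p * fst h + b p * snd h)) (at p)"
proof -
  obtain x t where p: "p = (x, t)" by (cases p)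
  have "((\<lambda>(x, t). f (x, t)) has_derivative
          (\<lambda>(h, k). a (x, t) * h + blinfun_apply (blinfun_mult_right (b (x, t))) k))
        (at (x, t) within UNIV \<times> UNIV)"
  proof (rule has_derivative_partialsI)
    show "((\<lambda>s. f (s, t)) has_derivative (*) (a (x, t))) (at x)"
      using C1_gradientD(1)[OF assms] by (simp add: has_field_derivative_def)
    show "((\<lambda>s. f (x, s)) has_derivative blinfun_apply (blinfun_mult_right (b (x, t)))) (at t)" for x t
      using C1_gradientD(2)[OF assms] by (simp add: has_field_derivative_def)
    have "isCont b (x, t)"
      using C1_gradientD(4)[OF assms] by (simp add: continuous_on_eq_continuous_at)
    then show "continuous (at (x, t) within UNIV \<times> UNIV) (\<lambda>(x, t). blinfun_mult_right (b (x, t)))"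
      unfolding case_prod_eta by (auto intro!: continuous_intros simp: split_beta')
  qed auto
  then show ?thesis
    by (simp add: p split_beta')
qed

lemma C1_gradient_continuous:
  assumes "C1_gradient f a b"
  shows "continuous_on UNIV f"
  using C1_gradient_has_derivative[OF assms]
  by (meson continuous_at_imp_continuous_on has_derivative_continuous)

lemma C1_gradient_chain:
  assumes "C1_gradient f a b"
    and "(X has_real_derivative X') (at s)" and "(T has_real_derivative T') (at s)"
  shows "((\<lambda>s. f (X s, T s)) has_real_derivative a (X s, T s) * X' + b (X s, T s) * T') (at s)"
proof -
  have "((\<lambda>s. (X s, T s)) has_derivative (\<lambda>h. (X' * h, T' * h))) (at s)"
    using assms(2,3) by (auto intro!: derivative_eq_intros simp: has_field_derivative_def)
  from has_derivative_compose[OF this C1_gradient_has_derivative[OF assms(1)]]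
  show ?thesis
    unfolding has_field_derivative_def by (rule has_derivative_eq_rhs) (auto simp: algebra_simps)
qed

section \<open>Primitives and stream functions\<close>

text \<open>
  The oriented integral of \<open>f\<close> from \<open>0\<close> to \<open>t\<close>: both integrals start at \<open>min t 0\<close>, so the
  formula has the right sign for negative \<open>t\<close> as well.
\<close>

definition primitive :: "(real \<Rightarrow> real) \<Rightarrow> real \<Rightarrow> real" where
  "primitive f t = integral {min t 0..t} f - integral {min t 0..0} f"

lemma primitive_eq:
  assumes "continuous_on UNIV f" "c \<le> t" "c \<le> 0"
  shows "primitive f t = integral {c..t} f - integral {c..0} f"
proof -
  have int: "f integrable_on {u..v}" for u v
    using assms(1) by (metis continuous_on_subset integrable_continuous_real subset_UNIV)
  have "integral {c..min t 0} f + integral {min t 0..t} f = integral {c..t} f"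
    "integral {c..min t 0} f + integral {min t 0..0} f = integral {c..0} f"
    using assms by (auto intro!: Henstock_Kurzweil_Integration.integral_combine int)
  then show ?thesis by (simp add: primitive_def)
qed

lemma primitive_has_derivative:
  assumes "continuous_on UNIV f"
  shows "(primitive f has_real_derivative f t) (at t)"
proof -
  define c where "c = min t 0 - 1"
  have "((\<lambda>u. integral {c..u} f) has_real_derivative f t) (at t within {c..t + 1})"
    by (rule integral_has_real_derivative) (auto simp: c_def intro: continuous_on_subset[OF assms])
  then have "((\<lambda>u. integral {c..u} f) has_real_derivative f t) (at t)"
    by (subst (asm) at_within_interior) (auto simp: c_def)
  then have "((\<lambda>u. integral {c..u} f - integral {c..0} f) has_real_derivative f t) (at t)"
    by (auto intro!: derivative_eq_intros)
  then show ?thesis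
  proof (rule has_field_derivative_transform_within_open)
    show "open {c<..}" "t \<in> {c<..}" by (auto simp: c_def)
    show "integral {c..u} f - integral {c..0} f = primitive f u" if "u \<in> {c<..}" for u
      using that by (intro primitive_eq[OF assms, symmetric]) (auto simp: c_def)
  qed
qed

lemma primitive_of_derivative:
  assumes "\<And>t. (F has_real_derivative f t) (at t)" "continuous_on UNIV f"
  shows "primitive f t = F t - F 0"
proof -
  have "((\<lambda>t. primitive f t - F t) has_real_derivative 0) (at t)" for t
    by (auto intro!: derivative_eq_intros primitive_has_derivative assms)
  then have "primitive f t - F t = primitive f 0 - F 0"
    by (metis DERIV_isconst_all)
  then show ?thesis by (simp add: primitive_def)
qed

lemma primitive_parametric_derivative:
  assumes "\<And>x t. ((\<lambda>s. f (s, t)) has_real_derivative f1 (x, t)) (at x)"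
    and "\<And>x. continuous_on UNIV (\<lambda>t. f (x, t))" and "continuous_on UNIV f1"
  shows "((\<lambda>x. primitive (\<lambda>s. f (x, s)) t) has_real_derivative primitive (\<lambda>s. f1 (x, s)) t) (at x)"
proof -
  have "((\<lambda>x. integral (cbox a b) (\<lambda>s. f (x, s))) has_real_derivative
          integral (cbox a b) (\<lambda>s. f1 (x, s))) (at x within UNIV)" for a b
  proof (rule leibniz_rule_field_derivative)
    show "(\<lambda>s. f (x, s)) integrable_on cbox a b" for x
      using assms(2) by (metis continuous_on_subset integrable_continuous subset_UNIV)
    show "continuous_on (UNIV \<times> cbox a b) (\<lambda>(x, s). f1 (x, s))"
      using assms(3) by (auto intro: continuous_on_subset)
  qed (use assms(1) in auto)
  then show ?thesis
    unfolding primitive_def by (auto intro!: derivative_eq_intros simp: cbox_interval)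
qed

lemma continuous_on_slices:
  assumes "continuous_on UNIV (f :: real \<times> real \<Rightarrow> real)"
  shows "continuous_on UNIV (\<lambda>t. f (x, t))" "continuous_on UNIV (\<lambda>t. f (t, x))"
  by (auto intro!: continuous_on_compose2[OF assms] continuous_intros)

text \<open>
  Differentiating \<open>u(x,t) = u(x,0) + \<integral>\<^sub>0\<^sup>t u2(x,s) ds\<close> in \<open>x\<close> under the integral
  sign expresses \<open>u1\<close>, up to a function of \<open>x\<close>, as a primitive of \<open>u21\<close> in \<open>t\<close>.
\<close>

lemma mixed_partials_commute:
  assumes "C1_gradient u u1 u2"
    and "\<And>x t. ((\<lambda>s. u2 (s, t)) has_real_derivative u21 (x, t)) (at x)"
    and "continuous_on UNIV u21"
  shows "((\<lambda>s. u1 (x, s)) has_real_derivative u21 (x, t)) (at t)"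
proof -
  have cont: "continuous_on UNIV (\<lambda>t. u2 (x, t))" for x
    by (rule continuous_on_slices C1_gradientD[OF assms(1)])+
  have u: "u (x, t) = u (x, 0) + primitive (\<lambda>s. u2 (x, s)) t" for x t
    using primitive_of_derivative[OF C1_gradientD(2)[OF assms(1), of x] cont] by simp
  have "((\<lambda>x. u (x, 0) + primitive (\<lambda>s. u2 (x, s)) t) has_real_derivative
        u1 (x, 0) + primitive (\<lambda>s. u21 (x, s)) t) (at x)" for x t
    by (auto intro!: derivative_eq_intros C1_gradientD[OF assms(1)]
        primitive_parametric_derivative assms cont)
  then have "((\<lambda>x. u (x, t)) has_real_derivative
        u1 (x, 0) + primitive (\<lambda>s. u21 (x, s)) t) (at x)" for x t
    by (subst u)
  from DERIV_unique[OF C1_gradientD(1)[OF assms(1)] this]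
  have "u1 (x, t) = u1 (x, 0) + primitive (\<lambda>s. u21 (x, s)) t" for x t .
  then have "(\<lambda>s. u1 (x, s)) = (\<lambda>t. u1 (x, 0) + primitive (\<lambda>s. u21 (x, s)) t)"
    by blast
  moreover have "((\<lambda>t. u1 (x, 0) + primitive (\<lambda>s. u21 (x, s)) t) has_real_derivative 0 + u21 (x, t)) (at t)"
    by (rule derivative_intros primitive_has_derivative continuous_on_slices assms)+
  ultimately show ?thesis by simp
qed

text \<open>
  The Poincare lemma in the plane: the hypotheses say that the field \<open>(-b, a)\<close> is curl free, and a
  potential is obtained by integrating it first along the axis \<open>t = 0\<close> and then vertically.
\<close>

lemma stream_function_exists:
  assumes "\<And>x t. ((\<lambda>s. a (s, t)) has_real_derivative a1 (x, t)) (at x)"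
    and "\<And>x t. ((\<lambda>s. b (x, s)) has_real_derivative - a1 (x, t)) (at t)"
    and "continuous_on UNIV a" "continuous_on UNIV b" "continuous_on UNIV a1"
  shows "\<exists>G. C1_gradient G (\<lambda>p. - b p) a"
proof -
  define G where "G = (\<lambda>(x, t). primitive (\<lambda>s. a (x, s)) t - primitive (\<lambda>r. b (r, 0)) x)"
  have "((\<lambda>x. G (x, t)) has_real_derivative
      primitive (\<lambda>s. a1 (x, s)) t - b (x, 0)) (at x)" for x t
    unfolding G_def split_conv
    by (rule derivative_intros primitive_parametric_derivative primitive_has_derivative
        continuous_on_slices assms)+
  moreover
  have "primitive (\<lambda>s. - (- a1 (x, s))) t = - b (x, t) - (- b (x, 0))" for x t
    by (rule primitive_of_derivative)
      (intro derivative_intros continuous_intros assms continuous_on_slices)+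
  then have "primitive (\<lambda>s. a1 (x, s)) t - b (x, 0) = - b (x, t)" for x t
    by simp
  ultimately have "((\<lambda>x. G (x, t)) has_real_derivative - b (x, t)) (at x)" for x t
    by metis
  moreover have "((\<lambda>t. G (x, t)) has_real_derivative a (x, t)) (at t)" for x t
    using primitive_has_derivative[OF continuous_on_slices(1)[OF assms(3)], of x t]
    unfolding G_def split_conv by (auto intro!: derivative_eq_intros)
  ultimately show ?thesis
    using assms by (auto simp: C1_gradient_def intro!: exI[of _ G] continuous_intros)
qed

section \<open>Implicitly defined functions\<close>

text \<open>
  If \<open>u s t1 < u s \<theta>(s) < u s t2\<close> holds at \<open>s0\<close>, it persists nearby by continuity in \<open>s\<close> alone, and
  monotonicity in the second variable turns this into \<open>t1 < \<theta>(s) < t2\<close>.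
\<close>

lemma implicit_continuous:
  fixes u :: "'a::t2_space \<Rightarrow> real \<Rightarrow> real"
  assumes "\<And>s. strict_mono (u s)" and "\<And>t. isCont (\<lambda>s. u s t) s0"
    and "isCont (\<lambda>s. u s (\<theta> s)) s0"
  shows "isCont \<theta> s0"
  unfolding continuous_at
proof (rule order_tendstoI)
  have lim: "((\<lambda>s. u s (\<theta> s) - u s t) \<longlongrightarrow> u s0 (\<theta> s0) - u s0 t) (at s0)" for t
    using assms(2,3) by (intro tendsto_diff) (auto simp: continuous_at)
  show "\<forall>\<^sub>F s in at s0. t < \<theta> s" if "t < \<theta> s0" for t
  proof -
    have "0 < u s0 (\<theta> s0) - u s0 t"
      using that assms(1) by (simp add: strict_mono_less)
    from order_tendstoD(1)[OF lim this] show ?thesis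
      by eventually_elim (use assms(1) in \<open>simp add: strict_mono_less\<close>)
  qed
  show "\<forall>\<^sub>F s in at s0. \<theta> s < t" if "\<theta> s0 < t" for t
  proof -
    have "u s0 (\<theta> s0) - u s0 t < 0"
      using that assms(1) by (simp add: strict_mono_less)
    from order_tendstoD(2)[OF lim this] show ?thesis
      by eventually_elim (use assms(1) in \<open>simp add: strict_mono_less\<close>)
  qed
qed

text \<open>
  The mean value theorem in the second variable writes
  \<open>u s (\<theta> s) - u s (\<theta> s0) = (\<theta> s - \<theta> s0) * du s \<xi>\<close> with \<open>\<xi>\<close> between \<open>\<theta> s0\<close> and \<open>\<theta> s\<close>; dividing by
  \<open>s - s0\<close> gives the difference quotient of \<open>\<theta>\<close>.
\<close>

lemma implicit_derivative:
  fixes u du :: "real \<Rightarrow> real \<Rightarrow> real"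
  assumes du: "\<And>s t. (u s has_real_derivative du s t) (at t)"
    and nz: "du s0 (\<theta> s0) \<noteq> 0"
    and cont: "isCont (\<lambda>(s, t). du s t) (s0, \<theta> s0)" "isCont \<theta> s0"
    and d: "((\<lambda>s. u s (\<theta> s0)) has_real_derivative d) (at s0)"
    and e: "((\<lambda>s. u s (\<theta> s)) has_real_derivative e) (at s0)"
  shows "(\<theta> has_real_derivative (e - d) / du s0 (\<theta> s0)) (at s0)"
proof -
  have "\<exists>\<xi>. \<bar>\<xi> - \<theta> s0\<bar> \<le> \<bar>\<theta> s - \<theta> s0\<bar> \<and>
            u s (\<theta> s) - u s (\<theta> s0) = (\<theta> s - \<theta> s0) * du s \<xi>" for s
  proof (cases "\<theta> s" "\<theta> s0" rule: linorder_cases)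
    case less
    obtain z where "\<theta> s < z" "z < \<theta> s0" "u s (\<theta> s0) - u s (\<theta> s) = (\<theta> s0 - \<theta> s) * du s z"
      using MVT2[OF less du, of s] by blast
    then show ?thesis by (intro exI[of _ z]) (auto simp: algebra_simps)
  next
    case greater
    obtain z where "\<theta> s0 < z" "z < \<theta> s" "u s (\<theta> s) - u s (\<theta> s0) = (\<theta> s - \<theta> s0) * du s z"
      using MVT2[OF greater du, of s] by blast
    then show ?thesis by (intro exI[of _ z]) (auto simp: algebra_simps)
  qed auto
  then obtain \<xi> where \<xi>: "\<And>s. \<bar>\<xi> s - \<theta> s0\<bar> \<le> \<bar>\<theta> s - \<theta> s0\<bar>"
    and mvt: "\<And>s. u s (\<theta> s) - u s (\<theta> s0) = (\<theta> s - \<theta> s0) * du s (\<xi> s)"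
    by metis
  have \<theta>: "(\<theta> \<longlongrightarrow> \<theta> s0) (at s0)" using cont(2) by (simp add: continuous_at)
  have "((\<lambda>s. \<xi> s - \<theta> s0) \<longlongrightarrow> 0) (at s0)"
    by (rule Lim_null_comparison[where g = "\<lambda>s. \<bar>\<theta> s - \<theta> s0\<bar>"])
      (use \<xi> \<theta> in \<open>auto intro!: tendsto_rabs_zero simp: LIM_zero_iff\<close>)
  then have "(\<xi> \<longlongrightarrow> \<theta> s0) (at s0)" by (simp add: LIM_zero_iff)
  then have "((\<lambda>s. (s, \<xi> s)) \<longlongrightarrow> (s0, \<theta> s0)) (at s0)" by (intro tendsto_intros)
  from isCont_tendsto_compose[OF cont(1) this]
  have lim: "((\<lambda>s. du s (\<xi> s)) \<longlongrightarrow> du s0 (\<theta> s0)) (at s0)" by simp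
  have "((\<lambda>s. (u s (\<theta> s) - u s0 (\<theta> s0)) / (s - s0) - (u s (\<theta> s0) - u s0 (\<theta> s0)) / (s - s0))
      \<longlongrightarrow> e - d) (at s0)"
    using d e by (intro tendsto_diff) (auto simp: has_field_derivative_iff)
  from tendsto_divide[OF this lim nz]
  have "((\<lambda>s. ((u s (\<theta> s) - u s0 (\<theta> s0)) / (s - s0) - (u s (\<theta> s0) - u s0 (\<theta> s0)) / (s - s0))
       / du s (\<xi> s)) \<longlongrightarrow> (e - d) / du s0 (\<theta> s0)) (at s0)" .
  moreover have "\<forall>\<^sub>F s in at s0. du s (\<xi> s) \<noteq> 0"
    using tendsto_imp_eventually_ne[OF lim nz] .
  then have "\<forall>\<^sub>F s in at s0. ((u s (\<theta> s) - u s0 (\<theta> s0)) / (s - s0)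
       - (u s (\<theta> s0) - u s0 (\<theta> s0)) / (s - s0)) / du s (\<xi> s) = (\<theta> s - \<theta> s0) / (s - s0)"
  proof eventually_elim
    case (elim s)
    have "(u s (\<theta> s) - u s0 (\<theta> s0)) / (s - s0) - (u s (\<theta> s0) - u s0 (\<theta> s0)) / (s - s0)
        = (u s (\<theta> s) - u s (\<theta> s0)) / (s - s0)"
      by (simp add: diff_divide_distrib)
    with elim show ?case by (simp add: mvt)
  qed
  ultimately show ?thesis
    unfolding has_field_derivative_iff by (rule Lim_transform_eventually)
qed

section \<open>Integrals of divergences over rectangles\<close>

lemma integral_partial_eq_0:
  fixes g :: "real \<times> real \<Rightarrow> real"
  assumes "continuous_on UNIV \<alpha>" and "a \<le> b" and "c \<le> d"
  shows "\<lbrakk>\<And>x t. ((\<lambda>s. g (s, t)) has_real_derivative \<alpha> (x, t)) (at x);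
          \<And>t. t \<in> {c..d} \<Longrightarrow> g (a, t) = g (b, t)\<rbrakk> \<Longrightarrow> integral (cbox (a, c) (b, d)) \<alpha> = 0"
    and "\<lbrakk>\<And>x t. ((\<lambda>s. g (x, s)) has_real_derivative \<alpha> (x, t)) (at t);
          \<And>x. x \<in> {a..b} \<Longrightarrow> g (x, c) = g (x, d)\<rbrakk> \<Longrightarrow> integral (cbox (a, c) (b, d)) \<alpha> = 0"
proof -
  have cont: "continuous_on (cbox (a, c) (b, d)) \<alpha>"
    using assms(1) continuous_on_subset by blast
  {
    assume deriv: "\<And>x t. ((\<lambda>s. g (x, s)) has_real_derivative \<alpha> (x, t)) (at t)"
      and bdry: "\<And>x. x \<in> {a..b} \<Longrightarrow> g (x, c) = g (x, d)"
    have "((\<lambda>t. \<alpha> (x, t)) has_integral (g (x, d) - g (x, c))) {c..d}" for x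
      by (rule fundamental_theorem_of_calculus)
        (use deriv \<open>c \<le> d\<close> in \<open>auto simp: has_real_derivative_iff_has_vector_derivative
          intro: has_vector_derivative_at_within\<close>)
    from integral_unique[OF this]
    have "integral {c..d} (\<lambda>t. \<alpha> (x, t)) = 0" if "x \<in> {a..b}" for x
      using bdry[OF that] by simp
    then have "integral (cbox a b) (\<lambda>x. integral (cbox c d) (\<lambda>t. \<alpha> (x, t))) = 0"
      by (subst integral_cong[where g = "\<lambda>_. 0"]) auto
    then show "integral (cbox (a, c) (b, d)) \<alpha> = 0"
      by (simp only: integral_prod_continuous[OF cont])
  }
  {
    assume deriv: "\<And>x t. ((\<lambda>s. g (s, t)) has_real_derivative \<alpha> (x, t)) (at x)"
      and bdry: "\<And>t. t \<in> {c..d} \<Longrightarrow> g (a, t) = g (b, t)"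
    have "((\<lambda>x. \<alpha> (x, t)) has_integral (g (b, t) - g (a, t))) {a..b}" for t
      by (rule fundamental_theorem_of_calculus)
        (use deriv \<open>a \<le> b\<close> in \<open>auto simp: has_real_derivative_iff_has_vector_derivative
          intro: has_vector_derivative_at_within\<close>)
    from integral_unique[OF this]
    have "integral {a..b} (\<lambda>x. \<alpha> (x, t)) = 0" if "t \<in> {c..d}" for t
      using bdry[OF that] by simp
    then have "integral (cbox c d) (\<lambda>t. integral (cbox a b) (\<lambda>x. \<alpha> (x, t))) = 0"
      by (subst integral_cong[where g = "\<lambda>_. 0"]) auto
    then show "integral (cbox (a, c) (b, d)) \<alpha> = 0"
      using integral_swap_continuous[of a c b d "\<lambda>x t. \<alpha> (x, t)"] cont
      by (simp add: integral_prod_continuous[OF cont])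
  }
qed

text \<open>
  Integrating first along the direction of differentiation leaves boundary values only, so two fields
  that agree on the boundary have divergences with the same integral.
\<close>

lemma integral_divergence_cong:
  fixes g g' h h' :: "real \<times> real \<Rightarrow> real"
  assumes g: "\<And>x t. ((\<lambda>s. g (s, t)) has_real_derivative \<alpha> (x, t)) (at x)"
      "\<And>x t. ((\<lambda>s. g' (s, t)) has_real_derivative \<alpha>' (x, t)) (at x)"
    and h: "\<And>x t. ((\<lambda>s. h (x, s)) has_real_derivative \<beta> (x, t)) (at t)"
      "\<And>x t. ((\<lambda>s. h' (x, s)) has_real_derivative \<beta>' (x, t)) (at t)"
    and cont: "continuous_on UNIV \<alpha>" "continuous_on UNIV \<beta>"
      "continuous_on UNIV \<alpha>'" "continuous_on UNIV \<beta>'"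
    and box: "a \<le> b" "c \<le> d"
    and bdry: "\<And>p. p \<in> cbox (a, c) (b, d) - box (a, c) (b, d) \<Longrightarrow> g p = g' p \<and> h p = h' p"
  shows "integral (cbox (a, c) (b, d)) (\<lambda>p. \<alpha> p + \<beta> p) =
         integral (cbox (a, c) (b, d)) (\<lambda>p. \<alpha>' p + \<beta>' p)"
proof -
  let ?Q = "cbox (a, c) (b, d)"
  have int: "f integrable_on ?Q" if "continuous_on UNIV f" for f :: "real \<times> real \<Rightarrow> real"
    using that by (metis continuous_on_subset integrable_continuous subset_UNIV)
  have "integral ?Q (\<lambda>p. \<alpha> p - \<alpha>' p) = 0"
    by (rule integral_partial_eq_0(1)[where g = "\<lambda>p. g p - g' p"])
      (use bdry box in \<open>auto intro!: derivative_intros continuous_intros g cont simp: mem_box Basis_prod_def\<close>)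
  moreover have "integral ?Q (\<lambda>p. \<beta> p - \<beta>' p) = 0"
    by (rule integral_partial_eq_0(2)[where g = "\<lambda>p. h p - h' p"])
      (use bdry box in \<open>auto intro!: derivative_intros continuous_intros h cont simp: mem_box Basis_prod_def\<close>)
  ultimately show ?thesis
    by (simp add: int cont integral_add integral_diff)
qed

section \<open>Calibration by the translates of a monotone solution\<close>

definition lagrangian :: "(real \<times> real \<Rightarrow> real) \<Rightarrow> (real \<times> real \<Rightarrow> real) \<Rightarrow>
    (real \<times> real \<Rightarrow> real) \<Rightarrow> (real \<times> real \<Rightarrow> real) \<Rightarrow> real \<times> real \<Rightarrow> real" where
  "lagrangian F u a b p = ((a p)\<^sup>2 + (b p)\<^sup>2) / 2 + F (fst p, u p)"

lemma lagrangian_continuous: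
  assumes "C1_gradient u a b" and "continuous_on UNIV F"
  shows "continuous_on UNIV (lagrangian F u a b)"
  unfolding lagrangian_def
  by (intro continuous_intros continuous_on_compose2[OF assms(2)] C1_gradientD[OF assms(1)]
      C1_gradient_continuous[OF assms(1)]) auto

text \<open>
  \<open>F\<close> does not depend on the second coordinate, so translations in that direction are a symmetry of
  the energy. Noether's theorem then makes the field
  \<open>(y1 y2, (y2\<^sup>2 - y1\<^sup>2)/2 - F)\<close> divergence free for a solution \<open>y\<close>, and \<open>G\<close> is its stream function.
\<close>

lemma noether_stream_function:
  assumes y: "C1_gradient y y1 y2" "C1_gradient y1 y11 y12" "C1_gradient y2 y21 y22"
    and F: "\<And>x s. ((\<lambda>s. F (x, s)) has_real_derivative f (x, s)) (at s)" "continuous_on UNIV F"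
    and eq: "\<And>p. y11 p + y22 p = f (fst p, y p)"
  shows "\<exists>G. C1_gradient G (\<lambda>p. ((y1 p)\<^sup>2 - (y2 p)\<^sup>2) / 2 + F (fst p, y p)) (\<lambda>p. y1 p * y2 p)"
proof -
  note cont = C1_gradient_continuous[OF y(1)] C1_gradient_continuous[OF y(2)]
    C1_gradient_continuous[OF y(3)] C1_gradientD(3,4)[OF y(2)] C1_gradientD(3,4)[OF y(3)]
  have y12: "((\<lambda>s. y1 (x, s)) has_real_derivative y21 (x, t)) (at t)" for x t
    using mixed_partials_commute[OF y(1) C1_gradientD(1,3)[OF y(3)]] .
  have "\<exists>G. C1_gradient G (\<lambda>p. - (((y2 p)\<^sup>2 - (y1 p)\<^sup>2) / 2 - F (fst p, y p))) (\<lambda>p. y1 p * y2 p)"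
  proof (rule stream_function_exists)
    show "((\<lambda>s. y1 (s, t) * y2 (s, t)) has_real_derivative
        (\<lambda>p. y11 p * y2 p + y1 p * y21 p) (x, t)) (at x)" for x t
      by (auto intro!: derivative_eq_intros C1_gradientD[OF y(2)] C1_gradientD[OF y(3)])
    have "((\<lambda>s. F (x, y (x, s))) has_real_derivative f (x, y (x, t)) * y2 (x, t)) (at t)" for x t
      using DERIV_chain2[OF F(1) C1_gradientD(2)[OF y(1)]] .
    then show "((\<lambda>s. ((y2 (x, s))\<^sup>2 - (y1 (x, s))\<^sup>2) / 2 - F (fst (x, s), y (x, s)))
        has_real_derivative - (\<lambda>p. y11 p * y2 p + y1 p * y21 p) (x, t)) (at t)" for x t
      using eq[of "(x, t)", symmetric]
      by (auto intro!: derivative_eq_intros C1_gradientD(2)[OF y(3)] y12 simp: field_simps)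
  qed (intro continuous_intros cont continuous_on_compose2[OF F(2)]; simp)+
  then show ?thesis by (simp add: algebra_simps diff_divide_distrib)
qed

text \<open>
  The translates \<open>y(x1, x2 + h)\<close> foliate the region between the two limits. If the leaf through the
  point \<open>(p, V p)\<close> is written \<open>V p = y (fst p, \<tau> p)\<close>, its slope there is
  \<open>P = (y1, y2)\<close> evaluated at \<open>(fst p, \<tau> p)\<close>, and the null Lagrangian of the foliation is
  \<open>P \<bullet> \<nabla>V - |P|\<^sup>2 / 2 + F = \<alpha> + \<beta>\<close>. Pulling back the stream function \<open>G\<close> and a primitive of \<open>y2\<^sup>2\<close>
  along \<open>\<tau>\<close> exhibits it as a divergence: the derivatives of \<open>\<tau>\<close> contain a denominator \<open>y2\<close>, which
  the factors \<open>y1 y2\<close> and \<open>y2\<^sup>2\<close> cancel.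
\<close>

lemma calibration_divergence:
  assumes y: "C1_gradient y y1 y2" "continuous_on UNIV F" "\<And>p. y2 p > 0"
    and G: "C1_gradient G (\<lambda>p. ((y1 p)\<^sup>2 - (y2 p)\<^sup>2) / 2 + F (fst p, y p)) (\<lambda>p. y1 p * y2 p)"
    and V: "C1_gradient V V1 V2" and \<tau>: "\<And>p. y (fst p, \<tau> p) = V p"
  defines "\<alpha> \<equiv> \<lambda>p. y1 (fst p, \<tau> p) * V1 p
      - ((y1 (fst p, \<tau> p))\<^sup>2 + (y2 (fst p, \<tau> p))\<^sup>2) / 2 + F (fst p, V p)"
    and "\<beta> \<equiv> \<lambda>p. y2 (fst p, \<tau> p) * V2 p"
  shows "((\<lambda>s. G (s, \<tau> (s, t))) has_real_derivative \<alpha> (x, t)) (at x)"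
    and "((\<lambda>s. primitive (\<lambda>r. (y2 (x, r))\<^sup>2) (\<tau> (x, s))) has_real_derivative \<beta> (x, t)) (at t)"
    and "continuous_on UNIV \<alpha>" and "continuous_on UNIV \<beta>"
proof -
  have mono: "strict_mono (\<lambda>t. y (x, t))" for x
    by (rule strict_monoI, rule DERIV_pos_imp_increasing)
      (use y(3) C1_gradientD(2)[OF y(1)] in blast)+
  have \<tau>_cont: "isCont \<tau> p" for p
  proof (rule implicit_continuous[where u = "\<lambda>p t. y (fst p, t)"])
    have "continuous_on UNIV (\<lambda>p::real \<times> real. y (fst p, t))" for t
      by (intro continuous_on_compose2[OF C1_gradient_continuous[OF y(1)]] continuous_intros) auto
    then show "isCont (\<lambda>p. y (fst p, t)) p" for t
      by (metis UNIV_I continuous_on_eq_continuous_at open_UNIV)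
    show "isCont (\<lambda>p. y (fst p, \<tau> p)) p"
      unfolding \<tau> using C1_gradient_continuous[OF V]
      by (metis UNIV_I continuous_on_eq_continuous_at open_UNIV)
  qed (rule mono)
  then have \<tau>_cont': "continuous_on UNIV \<tau>"
    by (simp add: continuous_on_eq_continuous_at)
  have y2_cont: "isCont y2 p" for p
    using C1_gradientD(4)[OF y(1)] by (metis UNIV_I continuous_on_eq_continuous_at open_UNIV)
  have y2_nz: "y2 p \<noteq> 0" for p
    using y(3)[of p] by simp
  have \<tau>_slices: "isCont (\<lambda>s. \<tau> (s, t)) x" "isCont (\<lambda>s. \<tau> (x, s)) t" for x t
    using continuous_on_slices[OF \<tau>_cont'] by (auto simp: continuous_on_eq_continuous_at)
  have \<tau>1: "((\<lambda>s. \<tau> (s, t)) has_real_derivative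
      (V1 (x, t) - y1 (x, \<tau> (x, t))) / y2 (x, \<tau> (x, t))) (at x)"
    by (rule implicit_derivative[where u = "\<lambda>s t. y (s, t)" and du = "\<lambda>s t. y2 (s, t)"])
      (use \<tau>[of "(_, t)"] C1_gradientD[OF y(1)] C1_gradientD[OF V] y2_cont y2_nz \<tau>_slices in auto)
  have \<tau>2: "((\<lambda>s. \<tau> (x, s)) has_real_derivative (V2 (x, t) - 0) / y2 (x, \<tau> (x, t))) (at t)"
  proof (rule implicit_derivative[where u = "\<lambda>s t. y (x, t)" and du = "\<lambda>s t. y2 (x, t)"])
    show "isCont (\<lambda>(s, t). y2 (x, t)) (t, \<tau> (x, t))"
    proof -
      have "continuous_on UNIV (\<lambda>p::real \<times> real. y2 (x, snd p))"
        by (intro continuous_on_compose2[OF C1_gradientD(4)[OF y(1)]] continuous_intros) auto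
      then show ?thesis
        unfolding split_beta' by (metis UNIV_I continuous_on_eq_continuous_at open_UNIV)
    qed
  qed (use \<tau>[of "(x, _)"] C1_gradientD[OF y(1)] C1_gradientD[OF V] y2_nz \<tau>_slices in auto)
  show "((\<lambda>s. G (s, \<tau> (s, t))) has_real_derivative \<alpha> (x, t)) (at x)"
    by (rule DERIV_cong[OF C1_gradient_chain[OF G DERIV_ident \<tau>1]])
      (use \<tau>[of "(x, t)"] y2_nz in \<open>simp add: \<alpha>_def power2_eq_square field_simps\<close>)
  have "continuous_on UNIV (\<lambda>r. (y2 (x, r))\<^sup>2)"
    by (intro continuous_intros continuous_on_slices C1_gradientD[OF y(1)])
  from DERIV_chain2[OF primitive_has_derivative[OF this] \<tau>2]
  show "((\<lambda>s. primitive (\<lambda>r. (y2 (x, r))\<^sup>2) (\<tau> (x, s))) has_real_derivative \<beta> (x, t)) (at t)"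
    by (rule DERIV_cong) (use y2_nz in \<open>simp add: \<beta>_def power2_eq_square\<close>)
  have cont: "continuous_on UNIV (\<lambda>p. f (fst p, \<tau> p))" if "continuous_on UNIV f"
    for f :: "real \<times> real \<Rightarrow> real"
    by (intro continuous_on_compose2[OF that] continuous_intros \<tau>_cont') auto
  show "continuous_on UNIV \<alpha>" "continuous_on UNIV \<beta>"
    unfolding \<alpha>_def \<beta>_def
    by (intro continuous_intros cont continuous_on_compose2[OF y(2)] C1_gradient_continuous[OF V]
        C1_gradientD[OF y(1)] C1_gradientD[OF V]; simp)+
qed

text \<open>
  The Lagrangian of \<open>V\<close> minus the null Lagrangian is \<open>|\<nabla>V - P|\<^sup>2 / 2 \<ge> 0\<close>, with equality for
  \<open>V = y\<close>, whereas the integral of the null Lagrangian is the same for \<open>V\<close> and \<open>y\<close> because both have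
  the same boundary values.
\<close>

lemma foliation_minimizes:
  assumes y: "C1_gradient y y1 y2" "C1_gradient y1 y11 y12" "C1_gradient y2 y21 y22"
    and F: "\<And>x s. ((\<lambda>s. F (x, s)) has_real_derivative f (x, s)) (at s)" "continuous_on UNIV F"
    and eq: "\<And>p. y11 p + y22 p = f (fst p, y p)"
    and pos: "\<And>p. y2 p > 0"
    and V: "C1_gradient V V1 V2" and range: "\<And>p. \<exists>t. y (fst p, t) = V p"
    and box: "a \<le> b" "c \<le> d"
    and bdry: "\<And>p. p \<in> cbox (a, c) (b, d) - box (a, c) (b, d) \<Longrightarrow> V p = y p"
  shows "integral (cbox (a, c) (b, d)) (lagrangian F y y1 y2) \<le>
         integral (cbox (a, c) (b, d)) (lagrangian F V V1 V2)"
proof -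
  let ?Q = "cbox (a, c) (b, d)"
  obtain G where G: "C1_gradient G (\<lambda>p. ((y1 p)\<^sup>2 - (y2 p)\<^sup>2) / 2 + F (fst p, y p)) (\<lambda>p. y1 p * y2 p)"
    using noether_stream_function[OF y F eq] by blast
  obtain \<tau> where \<tau>: "\<And>p. y (fst p, \<tau> p) = V p"
    using range by metis
  note div_V = calibration_divergence[OF y(1) F(2) pos G V \<tau>]
  have snd: "y (fst p, snd p) = y p" for p by simp
  note div_y = calibration_divergence[OF y(1) F(2) pos G y(1) snd]
  have int: "f integrable_on ?Q" if "continuous_on UNIV f" for f :: "real \<times> real \<Rightarrow> real"
    using that by (metis continuous_on_subset integrable_continuous subset_UNIV)
  have inj: "t = t'" if "y (x, t) = y (x, t')" for x t t'
    using DERIV_pos_imp_increasing[of _ _ "\<lambda>t. y (x, t)"] pos C1_gradientD(2)[OF y(1)] that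
    by (metis less_irrefl linorder_neqE)
  let ?H = "\<lambda>p. primitive (\<lambda>r. (y2 (fst p, r))\<^sup>2)"
  define cal where "cal = (\<lambda>\<tau> V V1 V2 (p :: real \<times> real). y1 (fst p, \<tau> p) * V1 p
      - ((y1 (fst p, \<tau> p))\<^sup>2 + (y2 (fst p, \<tau> p))\<^sup>2) / 2 + F (fst p, V p) + y2 (fst p, \<tau> p) * V2 p)"
  have "integral ?Q (cal snd y y1 y2) = integral ?Q (cal \<tau> V V1 V2)"
    unfolding cal_def
  proof (rule integral_divergence_cong[where g = "\<lambda>p. G (fst p, snd p)" and g' = "\<lambda>p. G (fst p, \<tau> p)"
        and h = "\<lambda>p. ?H p (snd p)" and h' = "\<lambda>p. ?H p (\<tau> p)"])
    fix p assume "p \<in> ?Q - box (a, c) (b, d)"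
    then have "\<tau> p = snd p" using bdry[of p] \<tau>[of p] inj by (metis prod.collapse)
    then show "G (fst p, snd p) = G (fst p, \<tau> p) \<and> ?H p (snd p) = ?H p (\<tau> p)" by simp
  qed (use div_V div_y box in simp_all)
  moreover have "cal snd y y1 y2 = lagrangian F y y1 y2"
    by (auto simp: cal_def lagrangian_def power2_eq_square field_simps)
  moreover have "integral ?Q (cal \<tau> V V1 V2) \<le> integral ?Q (lagrangian F V V1 V2)"
  proof (rule integral_le)
    have "continuous_on UNIV (cal \<tau> V V1 V2)"
      unfolding cal_def by (intro continuous_on_add div_V(3,4))
    then show "cal \<tau> V V1 V2 integrable_on ?Q" by (rule int)
    show "lagrangian F V V1 V2 integrable_on ?Q"
      by (intro int lagrangian_continuous V F)
    fix p
    have "0 \<le> ((V1 p - y1 (fst p, \<tau> p))\<^sup>2 + (V2 p - y2 (fst p, \<tau> p))\<^sup>2) / 2" by simp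
    then show "cal \<tau> V V1 V2 p \<le> lagrangian F V V1 V2 p"
      by (simp add: cal_def lagrangian_def power2_eq_square field_simps)
  qed
  ultimately show ?thesis by simp
qed

section \<open>Truncation of competitors at the limit profiles\<close>

text \<open>
  A \<open>C\<^sup>1\<close> contraction of the line into \<open>(-1, 1)\<close> that fixes \<open>[-m, m]\<close>. The last inequality says that it
  raises the double-well potential \<open>(1 - w\<^sup>2)\<^sup>2\<close> by no more than its value at \<open>m\<close>, which is small
  when \<open>m\<close> is close to \<open>1\<close>.
\<close>

lemma C1_truncation_exists:
  fixes m :: real
  assumes m: "0 < m" "m < 1"
  obtains k k' :: "real \<Rightarrow> real"
  where "\<And>w. (k has_real_derivative k' w) (at w)" "continuous_on UNIV k'"
    and "\<And>w. \<bar>k' w\<bar> \<le> 1" "\<And>w. \<bar>k w\<bar> < 1" "\<And>w. \<bar>w\<bar> \<le> m \<Longrightarrow> k w = w"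
    and "\<And>w. (1 - (k w)\<^sup>2)\<^sup>2 \<le> (1 - w\<^sup>2)\<^sup>2 + (1 - m\<^sup>2)\<^sup>2"
proof -
  define \<delta> where "\<delta> = 1 - m"
  have \<delta>: "\<delta> > 0" using m by (simp add: \<delta>_def)
  (* For u > 0 the difference u - r u is \<delta> u / (\<delta> + u), so subtracting r (w - m) from w bends the
     identity beyond m, with matching slope, into a hyperbola with asymptote m + \<delta> = 1. *)
  define r where "r u = (max 0 u)\<^sup>2 / (\<delta> + max 0 u)" for u
  define r' where "r' u = 1 - (\<delta> / (\<delta> + max 0 u))\<^sup>2" for u
  have r_deriv: "(r has_real_derivative r' u) (at u)" for u
  proof (cases u "0::real" rule: linorder_cases)
    case less
    have "((\<lambda>_. 0) has_real_derivative r' u) (at u)"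
      using less \<delta> by (simp add: r'_def)
    then show ?thesis
      by (rule has_field_derivative_transform_within_open[where S = "{..<0}"])
        (use less in \<open>auto simp: r_def\<close>)
  next
    case greater
    have "r' u = ((\<delta> + u)\<^sup>2 - \<delta>\<^sup>2) / (\<delta> + u)\<^sup>2"
      using greater \<delta> by (simp add: r'_def power_divide diff_divide_distrib)
    then have "((\<lambda>u. u\<^sup>2 / (\<delta> + u)) has_real_derivative r' u) (at u)"
      using greater \<delta>
      by (auto intro!: derivative_eq_intros simp: power2_eq_square algebra_simps)
    then show ?thesis
      by (rule has_field_derivative_transform_within_open[where S = "{0<..}"])
        (use greater in \<open>auto simp: r_def\<close>)
  next
    case equal
    have "isCont (\<lambda>u. max 0 u / (\<delta> + max 0 u)) 0"
      using \<delta> by (intro continuous_intros) auto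
    then have "((\<lambda>u. max 0 u / (\<delta> + max 0 u)) \<longlongrightarrow> 0) (at 0)"
      by (simp add: continuous_at)
    then have "((\<lambda>u. (r u - r 0) / (u - 0)) \<longlongrightarrow> 0) (at 0)"
      by (rule Lim_transform_eventually)
        (auto simp: eventually_at_filter r_def power2_eq_square max_def)
    then show ?thesis
      using equal \<delta> by (simp add: has_field_derivative_iff r'_def)
  qed
  have r'_bounds: "0 \<le> r' u" "r' u < 1" for u
    using \<delta> by (auto simp: r'_def power_le_one)
  have r_neg: "r u = 0" "r' u = 0" if "u \<le> 0" for u
    using that \<delta> by (auto simp: r_def r'_def max_def)
  define k where "k w = w - r (w - m) + r (- w - m)" for w
  define k' where "k' w = 1 - r' (w - m) - r' (- w - m)" for w
  have k_large: "m \<le> k w \<and> k w < 1" if "w > m" for w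
  proof -
    have "k w = m + \<delta> * (w - m) / (\<delta> + (w - m))"
      using that \<delta> m r_neg(1)[of "- w - m"]
      by (simp add: k_def r_def power2_eq_square field_simps)
    moreover have "\<delta> * (w - m) / (\<delta> + (w - m)) < \<delta>" "\<delta> * (w - m) / (\<delta> + (w - m)) \<ge> 0"
      using that \<delta> by (auto simp: divide_simps)
    ultimately show ?thesis by (simp add: \<delta>_def)
  qed
  have k_odd: "k (- w) = - k w" for w
    by (simp add: k_def)
  have k_id: "k w = w" if "\<bar>w\<bar> \<le> m" for w
    using that r_neg by (simp add: k_def)
  have k_abs: "m \<le> \<bar>k w\<bar> \<and> \<bar>k w\<bar> < 1" if "\<bar>w\<bar> > m" for w
    using k_large[of "\<bar>w\<bar>"] k_odd[of w] that m by (auto simp: abs_if split: if_splits)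
  show thesis
  proof
    show "(k has_real_derivative k' w) (at w)" for w
    proof -
      have "((\<lambda>w. r (w - m)) has_real_derivative r' (w - m)) (at w)"
        "((\<lambda>w. r (- w - m)) has_real_derivative - r' (- w - m)) (at w)"
        using DERIV_chain2[OF r_deriv DERIV_diff[OF DERIV_ident DERIV_const], of m w]
          DERIV_chain2[OF r_deriv DERIV_diff[OF DERIV_minus[OF DERIV_ident] DERIV_const], of m w]
        by simp_all
      from DERIV_add[OF DERIV_diff[OF DERIV_ident this(1)] this(2)] show ?thesis
        by (simp add: k_def[abs_def] k'_def)
    qed
    have "\<delta> + max 0 u \<noteq> 0" for u
      using \<delta> by (simp add: max_def)
    then show "continuous_on UNIV k'"
      unfolding k'_def r'_def by (intro continuous_intros) auto
    show "\<bar>k' w\<bar> \<le> 1" for w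
      using r'_bounds[of "w - m"] r'_bounds[of "- w - m"] r_neg(2)[of "w - m"]
        r_neg(2)[of "- w - m"] m by (cases "w \<ge> 0") (auto simp: k'_def)
    show "\<bar>k w\<bar> < 1" for w
      using k_abs[of w] k_id[of w] m by force
    show "k w = w" if "\<bar>w\<bar> \<le> m" for w
      using k_id that .
    show "(1 - (k w)\<^sup>2)\<^sup>2 \<le> (1 - w\<^sup>2)\<^sup>2 + (1 - m\<^sup>2)\<^sup>2" for w
    proof (cases "\<bar>w\<bar> \<le> m")
      case False
      then have "m\<^sup>2 \<le> \<bar>k w\<bar>\<^sup>2" "\<bar>k w\<bar>\<^sup>2 \<le> 1"
        using k_abs[of w] m by (intro power_mono power_le_one; simp)+
      then have "(1 - (k w)\<^sup>2)\<^sup>2 \<le> (1 - m\<^sup>2)\<^sup>2"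
        by (intro power_mono) auto
      then show ?thesis using zero_le_power2[of "1 - w\<^sup>2"] by linarith
    qed (simp add: k_id)
  qed
qed

definition painleve_potential :: "real \<times> real \<Rightarrow> real" where
  "painleve_potential = (\<lambda>(x, s). x * s\<^sup>2 / 2 + s ^ 4 / 2)"

lemma painleve_potential_continuous: "continuous_on UNIV painleve_potential"
  unfolding painleve_potential_def by (auto intro!: continuous_intros simp: split_beta')

lemma painleve_potential_derivative:
  "((\<lambda>s. painleve_potential (x, s)) has_real_derivative x * s + 2 * s ^ 3) (at s)"
  unfolding painleve_potential_def by (auto intro!: derivative_eq_intros)

text \<open>
  Completing the square with the logarithmic derivative \<open>q\<close> of the positive solution \<open>Y\<close>, which
  satisfies the Riccati equation \<open>q' = x + 2 Y\<^sup>2 - q\<^sup>2\<close>. Up to the divergence \<open>\<pi>\<close> and the fixed term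
  \<open>-Y\<^sup>4 / 2\<close>, the Lagrangian of \<open>u = Y w\<close> becomes the weighted Allen-Cahn density
  \<open>Y\<^sup>2 |\<nabla>w|\<^sup>2 / 2 + Y\<^sup>4 (w\<^sup>2 - 1)\<^sup>2 / 2\<close>, in which the coefficient \<open>x\<close> of indefinite sign has
  disappeared.
\<close>

lemma picone_identity:
  assumes Y: "\<And>x. Y x > 0" "\<And>x. (Y has_real_derivative Y' x) (at x)"
      "\<And>x. (Y' has_real_derivative x * Y x + 2 * Y x ^ 3) (at x)"
    and u: "C1_gradient u u1 u2" and q_eq: "\<And>x. q x = Y' x / Y x"
  obtains \<pi> where
    "\<And>x t. ((\<lambda>s. (u (s, t))\<^sup>2 * q s / 2) has_real_derivative \<pi> (x, t)) (at x)"
    "continuous_on UNIV \<pi>"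
    "\<And>p. lagrangian painleve_potential u u1 u2 p = \<pi> p +
       ((u1 p - q (fst p) * u p)\<^sup>2 + (u2 p)\<^sup>2 + ((u p)\<^sup>2 - (Y (fst p))\<^sup>2)\<^sup>2 - Y (fst p) ^ 4) / 2"
proof
  define \<pi> where "\<pi> = (\<lambda>p. u p * u1 p * q (fst p) +
     (u p)\<^sup>2 * (fst p + 2 * (Y (fst p))\<^sup>2 - (q (fst p))\<^sup>2) / 2)"
  have nz: "Y x \<noteq> 0" for x using Y(1)[of x] by simp
  have q: "(q has_real_derivative x + 2 * (Y x)\<^sup>2 - (q x)\<^sup>2) (at x)" for x
    unfolding q_eq[abs_def] by (rule DERIV_cong[OF DERIV_divide[OF Y(3) Y(2) nz]])
      (use nz[of x] in \<open>simp add: field_simps power2_eq_square power3_eq_cube\<close>)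
  show "((\<lambda>s. (u (s, t))\<^sup>2 * q s / 2) has_real_derivative \<pi> (x, t)) (at x)" for x t
    by (auto intro!: derivative_eq_intros C1_gradientD[OF u] q simp: \<pi>_def field_simps)
  have "continuous_on UNIV Y" "continuous_on UNIV q"
    using Y(2) q by (meson DERIV_continuous continuous_at_imp_continuous_on)+
  then have "continuous_on UNIV (\<lambda>p::real \<times> real. Y (fst p))" "continuous_on UNIV (\<lambda>p::real \<times> real. q (fst p))"
    by (auto intro!: continuous_on_compose2[of UNIV _ UNIV fst] continuous_intros)
  then show "continuous_on UNIV \<pi>"
    unfolding \<pi>_def
    by (intro continuous_intros C1_gradient_continuous[OF u] C1_gradientD[OF u]) auto
  show "lagrangian painleve_potential u u1 u2 p = \<pi> p +
       ((u1 p - q (fst p) * u p)\<^sup>2 + (u2 p)\<^sup>2 + ((u p)\<^sup>2 - (Y (fst p))\<^sup>2)\<^sup>2 - Y (fst p) ^ 4) / 2" for p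
    by (simp add: lagrangian_def painleve_potential_def \<pi>_def field_simps power2_eq_square power4_eq_xxxx)
qed

text \<open>
  Replacing \<open>w = v / Y\<close> by its truncation \<open>k(w)\<close> contracts the gradient term of the Allen-Cahn form
  and raises the potential term by at most \<open>(1 - m\<^sup>2)\<^sup>2 Y\<^sup>4 / 2\<close>. The divergence in the Picone identity
  is harmless because the boundary values of \<open>v\<close> lie in the range that \<open>k\<close> fixes.
\<close>

lemma truncation_energy:
  assumes Y: "\<And>x. Y x > 0" "\<And>x. (Y has_real_derivative Y' x) (at x)"
      "\<And>x. (Y' has_real_derivative x * Y x + 2 * Y x ^ 3) (at x)"
    and v: "C1_gradient v v1 v2" and m: "0 < m" "m < 1"
    and box: "a \<le> b" "c \<le> d"
    and bdry: "\<And>p. p \<in> cbox (a, c) (b, d) - box (a, c) (b, d) \<Longrightarrow> \<bar>v p\<bar> \<le> m * Y (fst p)"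
  obtains V V1 V2 where "C1_gradient V V1 V2" "\<And>p. \<bar>V p\<bar> < Y (fst p)"
    "\<And>p. p \<in> cbox (a, c) (b, d) - box (a, c) (b, d) \<Longrightarrow> V p = v p"
    "integral (cbox (a, c) (b, d)) (lagrangian painleve_potential V V1 V2) \<le>
     integral (cbox (a, c) (b, d)) (lagrangian painleve_potential v v1 v2) +
     (1 - m\<^sup>2)\<^sup>2 / 2 * integral (cbox (a, c) (b, d)) (\<lambda>p. Y (fst p) ^ 4)"
proof -
  let ?Q = "cbox (a, c) (b, d)" and ?F = painleve_potential
  have int: "f integrable_on ?Q" if "continuous_on UNIV f" for f :: "real \<times> real \<Rightarrow> real"
    using that by (metis continuous_on_subset integrable_continuous subset_UNIV)
  obtain k k' where k: "\<And>w. (k has_real_derivative k' w) (at w)" "continuous_on UNIV k'"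
    "\<And>w. \<bar>k' w\<bar> \<le> 1" "\<And>w. \<bar>k w\<bar> < 1" "\<And>w. \<bar>w\<bar> \<le> m \<Longrightarrow> k w = w"
    "\<And>w. (1 - (k w)\<^sup>2)\<^sup>2 \<le> (1 - w\<^sup>2)\<^sup>2 + (1 - m\<^sup>2)\<^sup>2"
    using C1_truncation_exists[OF m] by metis
  have nz: "Y x \<noteq> 0" for x using Y(1)[of x] by simp
  define q where "q = (\<lambda>x. Y' x / Y x)"
  define w where "w p = v p / Y (fst p)" for p
  define V where "V = (\<lambda>p. Y (fst p) * k (w p))"
  define V1 where "V1 = (\<lambda>p. q (fst p) * V p + k' (w p) * (v1 p - q (fst p) * v p))"
  define V2 where "V2 = (\<lambda>p. k' (w p) * v2 p)"
  have "continuous_on UNIV Y" "continuous_on UNIV Y'"  "continuous_on UNIV k"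
    using Y(2,3) k(1) by (meson DERIV_continuous continuous_at_imp_continuous_on)+
  then have Y_cont: "continuous_on UNIV (\<lambda>p::real \<times> real. Y (fst p))"
    and q_cont: "continuous_on UNIV (\<lambda>p::real \<times> real. q (fst p))"
    unfolding q_def using nz
    by (auto intro!: continuous_intros continuous_on_compose2[of UNIV _ UNIV fst])
  have w_cont: "continuous_on UNIV w"
    unfolding w_def using nz by (intro continuous_intros C1_gradient_continuous[OF v] Y_cont) auto
  have V_cont: "continuous_on UNIV V"
    unfolding V_def by (intro continuous_intros Y_cont
        continuous_on_compose2[OF \<open>continuous_on UNIV k\<close> w_cont]) auto
  have V: "C1_gradient V V1 V2"
    unfolding C1_gradient_def
  proof (intro conjI allI)
    fix x t
    have "((\<lambda>s. w (s, t)) has_real_derivative (v1 (x, t) - q x * v (x, t)) / Y x) (at x)"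
      unfolding w_def fst_conv
      by (rule DERIV_cong[OF DERIV_divide[OF C1_gradientD(1)[OF v] Y(2) nz]])
        (use nz[of x] in \<open>simp add: q_def field_simps\<close>)
    from DERIV_mult[OF Y(2) DERIV_chain2[OF k(1) this]]
    show "((\<lambda>s. V (s, t)) has_real_derivative V1 (x, t)) (at x)"
      unfolding V_def fst_conv
      by (rule DERIV_cong) (use nz[of x] in \<open>simp add: V1_def V_def q_def field_simps\<close>)
    have "((\<lambda>s. w (x, s)) has_real_derivative v2 (x, t) / Y x) (at t)"
      unfolding w_def fst_conv by (rule DERIV_cdivide[OF C1_gradientD(2)[OF v]])
    from DERIV_cmult[OF DERIV_chain2[OF k(1) this], of "Y x"]
    show "((\<lambda>s. V (x, s)) has_real_derivative V2 (x, t)) (at t)"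
      unfolding V_def fst_conv by (rule DERIV_cong) (use nz[of x] in \<open>simp add: V2_def\<close>)
    show "continuous_on UNIV V1" "continuous_on UNIV V2"
      unfolding V1_def V2_def
      by (intro continuous_intros V_cont q_cont continuous_on_compose2[OF k(2) w_cont]
          C1_gradientD[OF v] C1_gradient_continuous[OF v]; simp)+
  qed
  have V_bdry: "V p = v p" if "p \<in> ?Q - box (a, c) (b, d)" for p
  proof -
    have "\<bar>w p\<bar> \<le> m"
      using bdry[OF that] Y(1)[of "fst p"] by (simp add: w_def field_simps)
    then show ?thesis using nz by (simp add: V_def k(5)) (simp add: w_def)
  qed
  obtain \<pi>v where \<pi>v: "\<And>x t. ((\<lambda>s. (v (s, t))\<^sup>2 * q s / 2) has_real_derivative \<pi>v (x, t)) (at x)"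
    "continuous_on UNIV \<pi>v"
    "\<And>p. lagrangian ?F v v1 v2 p = \<pi>v p +
       ((v1 p - q (fst p) * v p)\<^sup>2 + (v2 p)\<^sup>2 + ((v p)\<^sup>2 - (Y (fst p))\<^sup>2)\<^sup>2 - Y (fst p) ^ 4) / 2"
    by (rule picone_identity[OF Y v, of q]) (simp add: q_def, rule that)
  obtain \<pi>V where \<pi>V: "\<And>x t. ((\<lambda>s. (V (s, t))\<^sup>2 * q s / 2) has_real_derivative \<pi>V (x, t)) (at x)"
    "continuous_on UNIV \<pi>V"
    "\<And>p. lagrangian ?F V V1 V2 p = \<pi>V p +
       ((V1 p - q (fst p) * V p)\<^sup>2 + (V2 p)\<^sup>2 + ((V p)\<^sup>2 - (Y (fst p))\<^sup>2)\<^sup>2 - Y (fst p) ^ 4) / 2"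
    by (rule picone_identity[OF Y V, of q]) (simp add: q_def, rule that)
  (* The divergences have only an x1-component, so the x2-components of both fields are 0. *)
  have flux: "integral ?Q \<pi>V = integral ?Q \<pi>v"
    using integral_divergence_cong[where g = "\<lambda>p. (V p)\<^sup>2 * q (fst p) / 2" and \<alpha> = \<pi>V
        and g' = "\<lambda>p. (v p)\<^sup>2 * q (fst p) / 2" and \<alpha>' = \<pi>v
        and h = "\<lambda>_. 0" and h' = "\<lambda>_. 0" and \<beta> = "\<lambda>_. 0" and \<beta>' = "\<lambda>_. 0",
        OF _ _ _ _ \<pi>V(2) _ \<pi>v(2) _ box] \<pi>v(1) \<pi>V(1) V_bdry
    by simp
  have ptwise: "lagrangian ?F V V1 V2 p - \<pi>V p \<le>
      lagrangian ?F v v1 v2 p - \<pi>v p + (1 - m\<^sup>2)\<^sup>2 / 2 * Y (fst p) ^ 4" for p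
  proof -
    have k'_sq: "(k' (w p))\<^sup>2 \<le> 1"
      using k(3)[of "w p"] by (simp add: abs_square_le_1)
    have "(V1 p - q (fst p) * V p)\<^sup>2 \<le> (v1 p - q (fst p) * v p)\<^sup>2"
      using mult_right_mono[OF k'_sq, of "(v1 p - q (fst p) * v p)\<^sup>2"]
      by (simp add: V1_def power_mult_distrib)
    moreover have "(V2 p)\<^sup>2 \<le> (v2 p)\<^sup>2"
      using mult_right_mono[OF k'_sq, of "(v2 p)\<^sup>2"] by (simp add: V2_def power_mult_distrib)
    moreover have "((V p)\<^sup>2 - (Y (fst p))\<^sup>2)\<^sup>2 \<le>
        ((v p)\<^sup>2 - (Y (fst p))\<^sup>2)\<^sup>2 + (1 - m\<^sup>2)\<^sup>2 * Y (fst p) ^ 4"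
    proof -
      have v_eq: "v p = Y (fst p) * w p" using nz by (simp add: w_def)
      have "((V p)\<^sup>2 - (Y (fst p))\<^sup>2)\<^sup>2 = Y (fst p) ^ 4 * (1 - (k (w p))\<^sup>2)\<^sup>2"
        unfolding V_def by algebra
      also have "\<dots> \<le> Y (fst p) ^ 4 * ((1 - (w p)\<^sup>2)\<^sup>2 + (1 - m\<^sup>2)\<^sup>2)"
        by (intro mult_left_mono k) simp
      also have "\<dots> = ((v p)\<^sup>2 - (Y (fst p))\<^sup>2)\<^sup>2 + (1 - m\<^sup>2)\<^sup>2 * Y (fst p) ^ 4"
        unfolding v_eq by algebra
      finally show ?thesis .
    qed
    ultimately show ?thesis unfolding \<pi>v(3) \<pi>V(3) by argo
  qed
  note conts = lagrangian_continuous[OF V painleve_potential_continuous]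
    lagrangian_continuous[OF v painleve_potential_continuous] \<pi>v(2) \<pi>V(2)
  have "integral ?Q (\<lambda>p. lagrangian ?F V V1 V2 p - \<pi>V p) \<le>
      integral ?Q (\<lambda>p. lagrangian ?F v v1 v2 p - \<pi>v p + (1 - m\<^sup>2)\<^sup>2 / 2 * Y (fst p) ^ 4)"
    by (intro integral_le ptwise int continuous_intros conts Y_cont)
  also have "\<dots> = integral ?Q (\<lambda>p. lagrangian ?F v v1 v2 p - \<pi>v p) +
      (1 - m\<^sup>2)\<^sup>2 / 2 * integral ?Q (\<lambda>p. Y (fst p) ^ 4)"
    by (subst integral_add) (auto intro!: int continuous_intros conts Y_cont)
  finally have "integral ?Q (lagrangian ?F V V1 V2) \<le> integral ?Q (lagrangian ?F v v1 v2) +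
      (1 - m\<^sup>2)\<^sup>2 / 2 * integral ?Q (\<lambda>p. Y (fst p) ^ 4)"
    using flux by (simp add: integral_diff int conts)
  moreover have "\<bar>V p\<bar> < Y (fst p)" for p
    using k(4)[of "w p"] Y(1)[of "fst p"] by (simp add: V_def abs_mult)
  ultimately show thesis using that V V_bdry by blast
qed

section \<open>Test functions and energies\<close>

lemma Ck_Suc_C1_gradient:
  assumes "Ck (Suc n) u"
  shows "C1_gradient u (D1 u) (D2 u)"
proof -
  have cont: "continuous_on UNIV f" if "Ck n f" for f
    using that by (cases n) simp_all
  have "(\<lambda>s. u (s, t)) differentiable (at x)" "(\<lambda>s. u (x, s)) differentiable (at t)" for x t
    using assms by simp_all
  then show ?thesis
    using assms cont[of "D1 u"] cont[of "D2 u"]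
    by (simp add: C1_gradient_def D1_def D2_def DERIV_deriv_iff_real_differentiable)
qed

lemma C1_gradient_D:
  assumes "C1_gradient f a b"
  shows "D1 f = a" and "D2 f = b"
  using DERIV_imp_deriv[OF C1_gradientD(1)[OF assms]] DERIV_imp_deriv[OF C1_gradientD(2)[OF assms]]
  by (simp_all add: D1_def D2_def fun_eq_iff)

lemma C1_gradient_add:
  assumes "C1_gradient f a b" "C1_gradient g a' b'"
  shows "C1_gradient (\<lambda>p. f p + g p) (\<lambda>p. a p + a' p) (\<lambda>p. b p + b' p)"
  unfolding C1_gradient_def
  by (intro conjI allI DERIV_add continuous_on_add C1_gradientD[OF assms(1)] C1_gradientD[OF assms(2)])

lemma zero_outside_supp:
  assumes "p \<notin> supp \<phi>"
  shows "\<phi> p = 0" "D1 \<phi> p = 0" "D2 \<phi> p = 0"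
proof -
  have zero: "\<phi> p = 0" if "p \<in> - supp \<phi>" for p
    using that closure_subset[of "{p. \<phi> p \<noteq> 0}"] by (auto simp: supp_def)
  then show "\<phi> p = 0" using assms by simp
  obtain x t where p: "p = (x, t)" by (cases p)
  have open_supp: "open (- supp \<phi>)" by (auto simp: supp_def)
  have "open ((\<lambda>s. (s, t)) -` (- supp \<phi>))" "open ((\<lambda>s. (x, s)) -` (- supp \<phi>))"
    by (intro open_vimage open_supp continuous_intros)+
  note S = this
  have "((\<lambda>s. \<phi> (s, t)) has_real_derivative 0) (at x)"
    by (rule has_field_derivative_transform_within_open[OF DERIV_const S(1)])
      (use assms p zero in auto)
  moreover have "((\<lambda>s. \<phi> (x, s)) has_real_derivative 0) (at t)"
    by (rule has_field_derivative_transform_within_open[OF DERIV_const S(2)])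
      (use assms p zero in auto)
  ultimately show "D1 \<phi> p = 0" "D2 \<phi> p = 0"
    by (auto simp: p D1_def D2_def intro!: DERIV_imp_deriv)
qed

lemma energy_eq_integral_lagrangian:
  assumes "C1_gradient u a b" and "compact S"
  shows "energy u S = integral S (lagrangian painleve_potential u a b)"
    and "lagrangian painleve_potential u a b integrable_on S"
proof -
  let ?L = "lagrangian painleve_potential u a b"
  have cont: "continuous_on UNIV ?L"
    by (rule lagrangian_continuous[OF assms(1) painleve_potential_continuous])
  obtain c d where "S \<subseteq> cbox c d"
    using bounded_subset_cbox_symmetric compact_imp_bounded[OF assms(2)] by metis
  moreover have "?L absolutely_integrable_on cbox c d"
    using cont continuous_on_subset by (intro absolutely_integrable_continuous) blast
  moreover have "S \<in> sets lebesgue"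
    using assms(2) by (simp add: lmeasurable_compact fmeasurableD)
  ultimately have int: "set_integrable lebesgue S ?L"
    using set_integrable_subset by blast
  have "energy u S = (LINT p:S|lebesgue. ?L p)"
    unfolding energy_def C1_gradient_D[OF assms(1)]
    by (simp add: lagrangian_def painleve_potential_def add.assoc)
  with set_lebesgue_integral_eq_integral[OF int]
  show "energy u S = integral S ?L" "?L integrable_on S" by simp_all
qed

text \<open>
  Outside the support of \<open>\<phi>\<close> the two densities agree, so comparing energies on the support, which may
  be an irregular set, amounts to comparing them on a surrounding rectangle.
\<close>

lemma energy_le_via_box:
  assumes y: "C1_gradient y y1 y2" and \<phi>: "C1_gradient \<phi> \<phi>1 \<phi>2"
    and supp: "compact (supp \<phi>)" "supp \<phi> \<subseteq> cbox a b"
    and le: "integral (cbox a b) (lagrangian painleve_potential y y1 y2) \<le>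
      integral (cbox a b) (lagrangian painleve_potential (\<lambda>p. y p + \<phi> p) (\<lambda>p. y1 p + \<phi>1 p) (\<lambda>p. y2 p + \<phi>2 p))"
  shows "energy y (supp \<phi>) \<le> energy (\<lambda>p. y p + \<phi> p) (supp \<phi>)"
proof -
  let ?Ly = "lagrangian painleve_potential y y1 y2"
  let ?Lv = "lagrangian painleve_potential (\<lambda>p. y p + \<phi> p) (\<lambda>p. y1 p + \<phi>1 p) (\<lambda>p. y2 p + \<phi>2 p)"
  note v = C1_gradient_add[OF y \<phi>]
  have "(\<lambda>p. ?Lv p - ?Ly p) integrable_on supp \<phi>"
    by (intro integrable_diff energy_eq_integral_lagrangian v y supp)
  then have "((\<lambda>p. ?Lv p - ?Ly p) has_integral integral (supp \<phi>) (\<lambda>p. ?Lv p - ?Ly p)) (cbox a b)"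
  proof (rule has_integral_on_superset[OF integrable_integral _ supp(2)])
    show "?Lv p - ?Ly p = 0" if "p \<notin> supp \<phi>" for p
      using zero_outside_supp[OF that] unfolding C1_gradient_D[OF \<phi>] by (simp add: lagrangian_def)
  qed
  then have "integral (supp \<phi>) (\<lambda>p. ?Lv p - ?Ly p) = integral (cbox a b) (\<lambda>p. ?Lv p - ?Ly p)"
    by (rule integral_unique[symmetric])
  also have "\<dots> = integral (cbox a b) ?Lv - integral (cbox a b) ?Ly"
    by (intro integral_diff energy_eq_integral_lagrangian v y compact_cbox)
  also have "\<dots> \<ge> 0" using le by simp
  finally have "0 \<le> integral (supp \<phi>) (\<lambda>p. ?Lv p - ?Ly p)" .
  also have "\<dots> = integral (supp \<phi>) ?Lv - integral (supp \<phi>) ?Ly"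
    by (intro integral_diff energy_eq_integral_lagrangian v y supp)
  finally show ?thesis
    unfolding energy_eq_integral_lagrangian(1)[OF v supp(1)]
      energy_eq_integral_lagrangian(1)[OF y supp(1)] by simp
qed

lemma range_of_increasing:
  fixes f :: "real \<Rightarrow> real"
  assumes mono: "strict_mono f" and cont: "continuous_on UNIV f"
    and top: "(f \<longlongrightarrow> B) at_top" and bot: "(f \<longlongrightarrow> A) at_bot"
  shows "range f = {A<..<B}"
proof
  have "f t < B" for t
  proof -
    have "f (t + 1) \<le> B"
    proof (rule tendsto_lowerbound[OF top])
      show "\<forall>\<^sub>F u in at_top. f (t + 1) \<le> f u"
        using eventually_ge_at_top[of "t + 1"] by eventually_elim (simp add: strict_mono_less_eq[OF mono])
    qed simp
    then show ?thesis using strict_monoD[OF mono, of t "t + 1"] by simp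
  qed
  moreover have "A < f t" for t
  proof -
    have "A \<le> f (t - 1)"
    proof (rule tendsto_upperbound[OF bot])
      show "\<forall>\<^sub>F u in at_bot. f u \<le> f (t - 1)"
        using eventually_le_at_bot[of "t - 1"] by eventually_elim (simp add: strict_mono_less_eq[OF mono])
    qed simp
    then show ?thesis using strict_monoD[OF mono, of "t - 1" t] by simp
  qed
  ultimately show "range f \<subseteq> {A<..<B}" by auto
  show "{A<..<B} \<subseteq> range f"
  proof
    fix s assume s: "s \<in> {A<..<B}"
    obtain a where a: "f a < s"
      using eventually_happens'[OF trivial_limit_at_bot_linorder order_tendstoD(2)[OF bot, of s]] s by auto
    obtain b where b: "s < f b"
      using eventually_happens'[OF trivial_limit_at_top_linorder order_tendstoD(1)[OF top, of s]] s by auto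
    have "a \<le> b"
      using a b strict_mono_less[OF mono, of a b] by simp
    then have "\<exists>t\<ge>a. t \<le> b \<and> f t = s"
      using a b by (intro IVT' continuous_on_subset[OF cont]) auto
    then show "s \<in> range f" by blast
  qed
qed

section \<open>Minimality of the monotone solution\<close>

theorem theorem1:
  fixes Y :: "real \<Rightarrow> real" and y :: "real \<times> real \<Rightarrow> real"
  assumes "hastings_mcleod Y"
    and "Ck 2 y"
    and "\<And>x1 x2. laplacian y (x1, x2) - x1 * y (x1, x2) - 2 * y (x1, x2) ^ 3 = 0"
    and "\<And>p. D2 y p > 0"
    and "tendsto_C2_loc (\<lambda>l (x1, x2). y (x1, x2 + l)) (\<lambda>(x1, x2). Y x1) at_top"
    and "tendsto_C2_loc (\<lambda>l (x1, x2). y (x1, x2 + l)) (\<lambda>(x1, x2). - Y x1) at_bot"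
  shows "\<forall>\<phi>. test_function \<phi> \<longrightarrow>
           energy y (supp \<phi>) \<le> energy (\<lambda>p. y p + \<phi> p) (supp \<phi>)"
proof (intro allI impI)
  fix \<phi> assume \<phi>: "test_function \<phi>"
  let ?F = painleve_potential
  have Ck: "Ck (Suc (Suc 0)) y" using assms(2) by (simp add: numeral_2_eq_2)
  then have Ck_D: "Ck (Suc 0) (D1 y)" "Ck (Suc 0) (D2 y)" by auto
  note y = Ck_Suc_C1_gradient[OF Ck] Ck_Suc_C1_gradient[OF Ck_D(1)] Ck_Suc_C1_gradient[OF Ck_D(2)]
  have pde: "D1 (D1 y) p + D2 (D2 y) p = (\<lambda>(x, s). x * s + 2 * s ^ 3) (fst p, y p)" for p
    using assms(3)[of "fst p" "snd p"] by (simp add: laplacian_def)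
  have hm: "Y x > 0" "Y differentiable (at x)" "deriv Y differentiable (at x)"
      "deriv (deriv Y) x - x * Y x - 2 * Y x ^ 3 = 0" for x
    using assms(1) unfolding hastings_mcleod_def by blast+
  have Y: "Y x > 0" "(Y has_real_derivative deriv Y x) (at x)"
      "(deriv Y has_real_derivative x * Y x + 2 * Y x ^ 3) (at x)" for x
  proof -
    have "deriv (deriv Y) x = x * Y x + 2 * Y x ^ 3" using hm(4)[of x] by simp
    then show "Y x > 0" "(Y has_real_derivative deriv Y x) (at x)"
      "(deriv Y has_real_derivative x * Y x + 2 * Y x ^ 3) (at x)"
      using hm(1-3)[of x] by (metis DERIV_deriv_iff_real_differentiable)+
  qed
  have range_y: "range (\<lambda>t. y (x, t)) = {- Y x<..<Y x}" for x
  proof (rule range_of_increasing)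
    show "strict_mono (\<lambda>t. y (x, t))"
      by (rule strict_monoI, rule DERIV_pos_imp_increasing)
        (use assms(4) C1_gradientD(2)[OF y(1)] in blast)+
    show "continuous_on UNIV (\<lambda>t. y (x, t))"
      by (intro continuous_on_slices C1_gradient_continuous[OF y(1)])
    have "uniform_limit {(x, 0)} (\<lambda>l (x1, x2). y (x1, x2 + l)) (\<lambda>(x1, x2). Y x1) at_top"
      "uniform_limit {(x, 0)} (\<lambda>l (x1, x2). y (x1, x2 + l)) (\<lambda>(x1, x2). - Y x1) at_bot"
      using assms(5,6) compact_sing unfolding tendsto_C2_loc_def by blast+
    then show "((\<lambda>t. y (x, t)) \<longlongrightarrow> Y x) at_top" "((\<lambda>t. y (x, t)) \<longlongrightarrow> - Y x) at_bot"
      by simp_all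
  qed
  have y_less: "\<bar>y p\<bar> < Y (fst p)" for p
    using rangeI[of "\<lambda>t. y (fst p, t)" "snd p"] unfolding range_y by auto
  have "Ck (Suc 0) \<phi>" "compact (supp \<phi>)"
    using \<phi> unfolding test_function_def by blast+
  note \<phi>_C1 = Ck_Suc_C1_gradient[OF this(1)] and supp = this(2)
  (* Inserting 0 keeps the rectangle nondegenerate when the support is empty. *)
  obtain r where r: "insert 0 (supp \<phi>) \<subseteq> box (- r) r"
    using bounded_subset_box_symmetric compact_imp_bounded[OF supp] bounded_insert by metis
  obtain r1 r2 where r_eq: "r = (r1, r2)" by (cases r)
  define Q where "Q = cbox (- r1, - r2) (r1, r2)"
  have box: "- r1 \<le> r1" "- r2 \<le> r2" and zero_Q: "0 \<in> Q"
    using r by (auto simp: r_eq Q_def mem_box Basis_prod_def)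
  have supp_box: "supp \<phi> \<subseteq> box (- r1, - r2) (r1, r2)"
    using r by (simp add: r_eq)
  have \<phi>_bdry: "y p + \<phi> p = y p" if "p \<in> cbox (- r1, - r2) (r1, r2) - box (- r1, - r2) (r1, r2)" for p
    using that supp_box zero_outside_supp(1)[of p \<phi>] by auto
  (* By compactness |y| / Y stays below some m0 < 1 on Q, so truncation at any level m > m0 does
     not change the competitor on the boundary of Q, where it equals y. *)
  have "continuous_on UNIV Y"
    using Y(2) by (meson DERIV_continuous continuous_at_imp_continuous_on)
  then have "continuous_on Q (\<lambda>p. \<bar>y p\<bar> / Y (fst p))"
    using Y(1) by (intro continuous_intros continuous_on_compose2[of UNIV Y Q fst]
        continuous_on_subset[OF C1_gradient_continuous[OF y(1)]]) (auto simp: less_imp_neq[symmetric])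
  moreover have "compact Q" "Q \<noteq> {}" using zero_Q by (auto simp: Q_def)
  ultimately have "\<exists>p0\<in>Q. \<forall>p\<in>Q. \<bar>y p\<bar> / Y (fst p) \<le> \<bar>y p0\<bar> / Y (fst p0)"
    by (intro continuous_attains_sup)
  then obtain p0 where p0: "\<And>p. p \<in> Q \<Longrightarrow> \<bar>y p\<bar> / Y (fst p) \<le> \<bar>y p0\<bar> / Y (fst p0)"
    by blast
  define m0 where "m0 = \<bar>y p0\<bar> / Y (fst p0)"
  have m0: "0 \<le> m0" "m0 < 1"
    using y_less[of p0] Y(1)[of "fst p0"] by (auto simp: m0_def)
  let ?Ly = "integral Q (lagrangian ?F y (D1 y) (D2 y))"
  let ?Lv = "integral Q (lagrangian ?F (\<lambda>p. y p + \<phi> p) (\<lambda>p. D1 y p + D1 \<phi> p) (\<lambda>p. D2 y p + D2 \<phi> p))"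
  let ?C = "integral Q (\<lambda>p. Y (fst p) ^ 4)"
  have approx: "?Ly \<le> ?Lv + (1 - m\<^sup>2)\<^sup>2 / 2 * ?C" if m: "m0 < m" "m < 1" for m
  proof -
    have bdry: "\<bar>y p + \<phi> p\<bar> \<le> m * Y (fst p)"
      if p: "p \<in> cbox (- r1, - r2) (r1, r2) - box (- r1, - r2) (r1, r2)" for p
    proof -
      have "\<bar>y p\<bar> / Y (fst p) \<le> m"
        using p0[of p] p m by (simp add: Q_def m0_def)
      then show ?thesis
        using \<phi>_bdry[OF p] Y(1)[of "fst p"] by (simp add: field_simps)
    qed
    have "0 < m" using m0 m by simp
    obtain V V1 V2 where V: "C1_gradient V V1 V2" "\<And>p. \<bar>V p\<bar> < Y (fst p)"
      "\<And>p. p \<in> Q - box (- r1, - r2) (r1, r2) \<Longrightarrow> V p = y p + \<phi> p"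
      "integral Q (lagrangian ?F V V1 V2) \<le> ?Lv + (1 - m\<^sup>2)\<^sup>2 / 2 * ?C"
      by (rule truncation_energy[OF Y C1_gradient_add[OF y(1) \<phi>_C1] \<open>0 < m\<close> m(2) box bdry,
            folded Q_def]) (assumption, rule that)
    have range: "\<exists>t. y (fst p, t) = V p" for p
    proof -
      have "V p \<in> range (\<lambda>t. y (fst p, t))"
        using V(2)[of p] unfolding range_y by auto
      then show ?thesis by force
    qed
    have F: "((\<lambda>s. ?F (x, s)) has_real_derivative (\<lambda>(x, s). x * s + 2 * s ^ 3) (x, s)) (at s)" for x s
      using painleve_potential_derivative by simp
    have "?Ly \<le> integral Q (lagrangian ?F V V1 V2)"
      unfolding Q_def
      by (rule foliation_minimizes[OF y F painleve_potential_continuous pde assms(4) V(1) range box])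
        (rule trans[OF V(3)[unfolded Q_def] \<phi>_bdry])
    with V(4) show ?thesis by simp
  qed
  (* Let m tend to 1: the price of truncation tends to 0. *)
  have "?Ly \<le> ?Lv + (1 - 1\<^sup>2)\<^sup>2 / 2 * ?C"
  proof (rule tendsto_lowerbound)
    show "((\<lambda>m. ?Lv + (1 - m\<^sup>2)\<^sup>2 / 2 * ?C) \<longlongrightarrow> ?Lv + (1 - 1\<^sup>2)\<^sup>2 / 2 * ?C) (at_left (1::real))"
      by (intro tendsto_intros) simp_all
    show "\<forall>\<^sub>F m in at_left (1::real). ?Ly \<le> ?Lv + (1 - m\<^sup>2)\<^sup>2 / 2 * ?C"
      using eventually_at_left_real[OF m0(2)] by eventually_elim (rule approx; simp)
  qed auto
  then show "energy y (supp \<phi>) \<le> energy (\<lambda>p. y p + \<phi> p) (supp \<phi>)"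
    by (intro energy_le_via_box[OF y(1) \<phi>_C1 supp order_trans[OF supp_box box_subset_cbox]])
      (simp add: Q_def)
qed

end
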